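(* Let $\Omega$ be a bounded open subset of $\mathbb{R}^n$, $\alpha\in(0,1]$, and let $\mathcal{K}\subseteq C^{0,\alpha}(\mathrm{cl}\,\Omega)$. Then the following conditions are equivalent. (i) The set $\mathcal{K}$ is relatively compact in $\left(C^{0,\alpha}(\mathrm{cl}\,\Omega),\|\cdot\|_{0,\alpha}\right)$. (ii) For all $\mathbf{x}\in\Omega$, the set $\{k(\mathbf{x}):k\in\mathcal{K}\}$ is relatively compact in $\mathbb{R}$, and for all $\epsilon>0$ there exists a finite covering $\mathcal{F}$ of $(\Omega\times\Omega)\setminus\Delta$ by open subsets $F$ of $(\Omega\times\Omega)\setminus\Delta$ such that $\mathrm{diam}\left(S[k](F)\right)<\epsilon$ for all $F\in\mathcal{F}$ and all $k\in\mathcal{K}$.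
   Context: $\mathrm{cl}\,\Omega$ denotes the closure of $\Omega$ in $\mathbb{R}^n$, and $\Delta=\{(\mathbf{x},\mathbf{x}):\mathbf{x}\in\mathbb{R}^n\}$. All functions are real-valued. $C^{0}(\mathrm{cl}\,\Omega)$ is the space of continuous functions on $\Omega$ that have a continuous extension to $\mathrm{cl}\,\Omega$ (the extension is denoted by the same symbol), with norm $\|f\|_0=\sup_{\mathrm{cl}\,\Omega}|f|$. For a function $f$ on $\mathrm{cl}\,\Omega$, its Hölder quotient is $|f|_\alpha=\sup\left\{\frac{|f(\mathbf{x})-f(\mathbf{y})|}{|\mathbf{x}-\mathbf{y}|^\alpha}:\mathbf{x},\mathbf{y}\in\mathrm{cl}\,\Omega,\ \mathbf{x}\neq\mathbf{y}\right\}$. $C^{0,\alpha}(\mathrm{cl}\,\Omega)$ is the subspace of those $f\in C^0(\mathrm{cl}\,\Omega)$ that are Hölder continuous with exponent $\alpha$ (i.e. $|f|_\alpha<+\infty$), with norm $\|f\|_{0,\alpha}=\|f\|_0+|f|_\alpha$. For $g\in C^{0,\alpha}(\mathrm{cl}\,\Omega)$, $S[g]$ is the bounded continuous function on $(\Omega\times\Omega)\setminus\Delta$ given by $S[g](\mathbf{x},\mathbf{y})=\frac{g(\mathbf{x})-g(\mathbf{y})}{|\mathbf{x}-\mathbf{y}|^\alpha}$. A subset of a Banach space is relatively compact if its closure is compact. $\mathrm{diam}\,A$ is the diameter of a set $A$. *)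

theory Defs
  imports "HOL-Analysis.Analysis"
begin

definition sup_norm :: "(real ^ 'n) set \<Rightarrow> (real ^ 'n \<Rightarrow> real) \<Rightarrow> ennreal" where
  "sup_norm \<Omega> f = (SUP x\<in>closure \<Omega>. ennreal \<bar>f x\<bar>)"

definition hoelder_quotient :: "(real ^ 'n) set \<Rightarrow> real \<Rightarrow> (real ^ 'n \<Rightarrow> real) \<Rightarrow> ennreal" where
  "hoelder_quotient \<Omega> \<alpha> f =
    (SUP (x, y)\<in>{(x, y). x \<in> closure \<Omega> \<and> y \<in> closure \<Omega> \<and> x \<noteq> y}.
       ennreal (\<bar>f x - f y\<bar> / norm (x - y) powr \<alpha>))"

(* A continuous function on Omega with a continuous extension to cl Omega is represented by that
   (unique) extension; extensionality makes functions that agree on cl Omega equal. *)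
definition C0_space :: "(real ^ 'n) set \<Rightarrow> (real ^ 'n \<Rightarrow> real) set" where
  "C0_space \<Omega> = {f \<in> extensional (closure \<Omega>). continuous_on (closure \<Omega>) f}"

definition hoelder_space :: "(real ^ 'n) set \<Rightarrow> real \<Rightarrow> (real ^ 'n \<Rightarrow> real) set" where
  "hoelder_space \<Omega> \<alpha> = {f \<in> C0_space \<Omega>. hoelder_quotient \<Omega> \<alpha> f < \<infinity>}"

(* The norm is computed in the extended nonnegative reals, where suprema over the empty set are 0
   and unbounded ones infinite. It is finite on the Hoelder space when Omega is bounded. *)
definition hoelder_norm :: "(real ^ 'n) set \<Rightarrow> real \<Rightarrow> (real ^ 'n \<Rightarrow> real) \<Rightarrow> real" where
  "hoelder_norm \<Omega> \<alpha> f = enn2real (sup_norm \<Omega> f + hoelder_quotient \<Omega> \<alpha> f)"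

definition hoelder_dist ::
    "(real ^ 'n) set \<Rightarrow> real \<Rightarrow> (real ^ 'n \<Rightarrow> real) \<Rightarrow> (real ^ 'n \<Rightarrow> real) \<Rightarrow> real" where
  "hoelder_dist \<Omega> \<alpha> f g = hoelder_norm \<Omega> \<alpha> (\<lambda>x. f x - g x)"

definition hoelder_topology :: "(real ^ 'n) set \<Rightarrow> real \<Rightarrow> (real ^ 'n \<Rightarrow> real) topology" where
  "hoelder_topology \<Omega> \<alpha> = Metric_space.mtopology (hoelder_space \<Omega> \<alpha>) (hoelder_dist \<Omega> \<alpha>)"

definition relatively_compactin :: "'a topology \<Rightarrow> 'a set \<Rightarrow> bool" where
  "relatively_compactin X A \<longleftrightarrow> A \<subseteq> topspace X \<and> compactin X (X closure_of A)"

definition off_diagonal :: "(real ^ 'n) set \<Rightarrow> ((real ^ 'n) \<times> (real ^ 'n)) set" where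
  "off_diagonal \<Omega> = \<Omega> \<times> \<Omega> - {(x, x) |x. x \<in> UNIV}"

definition S_quotient ::
    "real \<Rightarrow> (real ^ 'n \<Rightarrow> real) \<Rightarrow> (real ^ 'n) \<times> (real ^ 'n) \<Rightarrow> real" where
  "S_quotient \<alpha> g = (\<lambda>(x, y). (g x - g y) / norm (x - y) powr \<alpha>)"

lemma sup_norm_triangle:
  "sup_norm \<Omega> (\<lambda>x. f x + g x) \<le> sup_norm \<Omega> f + sup_norm \<Omega> g"
  unfolding sup_norm_def
proof (rule SUP_least)
  fix x assume x: "x \<in> closure \<Omega>"
  have "ennreal \<bar>f x + g x\<bar> \<le> ennreal (\<bar>f x\<bar> + \<bar>g x\<bar>)"
    by (intro ennreal_leI abs_triangle_ineq)
  also have "\<dots> = ennreal \<bar>f x\<bar> + ennreal \<bar>g x\<bar>" by simp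
  also have "\<dots> \<le> (SUP x\<in>closure \<Omega>. ennreal \<bar>f x\<bar>) + (SUP x\<in>closure \<Omega>. ennreal \<bar>g x\<bar>)"
    using x by (intro add_mono SUP_upper)
  finally show "ennreal \<bar>f x + g x\<bar> \<le> \<dots>" .
qed

lemma hoelder_quotient_triangle:
  "hoelder_quotient \<Omega> \<alpha> (\<lambda>x. f x + g x) \<le> hoelder_quotient \<Omega> \<alpha> f + hoelder_quotient \<Omega> \<alpha> g"
  unfolding hoelder_quotient_def
proof (rule SUP_least, clarify)
  fix x y assume xy: "x \<in> closure \<Omega>" "y \<in> closure \<Omega>" "x \<noteq> y"
  let ?D = "{(x, y). x \<in> closure \<Omega> \<and> y \<in> closure \<Omega> \<and> x \<noteq> y}"
  let ?q = "\<lambda>h (x, y). ennreal (\<bar>h x - h y\<bar> / norm (x - y) powr \<alpha>)"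
  have "\<bar>f x + g x - (f y + g y)\<bar> \<le> \<bar>f x - f y\<bar> + \<bar>g x - g y\<bar>" by linarith
  then have "ennreal (\<bar>f x + g x - (f y + g y)\<bar> / norm (x - y) powr \<alpha>)
      \<le> ennreal (\<bar>f x - f y\<bar> / norm (x - y) powr \<alpha> + \<bar>g x - g y\<bar> / norm (x - y) powr \<alpha>)"
    by (intro ennreal_leI) (simp add: divide_right_mono flip: add_divide_distrib)
  also have "\<dots> = ?q f (x, y) + ?q g (x, y)" by simp
  also have "\<dots> \<le> (SUP p\<in>?D. ?q f p) + (SUP p\<in>?D. ?q g p)"
    using xy by (intro add_mono SUP_upper) auto
  finally show "ennreal (\<bar>f x + g x - (f y + g y)\<bar> / norm (x - y) powr \<alpha>) \<le> \<dots>" .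
qed

lemma sup_norm_uminus: "sup_norm \<Omega> (\<lambda>x. g x - f x) = sup_norm \<Omega> (\<lambda>x. f x - g x)"
  by (simp add: sup_norm_def abs_minus_commute)

lemma hoelder_quotient_uminus:
  "hoelder_quotient \<Omega> \<alpha> (\<lambda>x. g x - f x) = hoelder_quotient \<Omega> \<alpha> (\<lambda>x. f x - g x)"
proof -
  have "\<bar>g x - f x - (g y - f y)\<bar> = \<bar>f x - g x - (f y - g y)\<bar>" for x y by linarith
  then show ?thesis by (simp add: hoelder_quotient_def)
qed

lemma hoelder_norm_finite_diff:
  assumes "bounded \<Omega>" "f \<in> hoelder_space \<Omega> \<alpha>" "g \<in> hoelder_space \<Omega> \<alpha>"
  shows "sup_norm \<Omega> (\<lambda>x. f x - g x) + hoelder_quotient \<Omega> \<alpha> (\<lambda>x. f x - g x) < \<infinity>"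
proof -
  have "compact ((\<lambda>x. f x - g x) ` closure \<Omega>)"
    using assms by (intro compact_continuous_image continuous_intros)
      (auto simp: hoelder_space_def C0_space_def)
  then obtain B where "\<And>x. x \<in> closure \<Omega> \<Longrightarrow> \<bar>f x - g x\<bar> \<le> B"
    by (force dest: compact_imp_bounded simp: bounded_iff)
  then have "sup_norm \<Omega> (\<lambda>x. f x - g x) \<le> ennreal B"
    unfolding sup_norm_def by (intro SUP_least ennreal_leI)
  then have 1: "sup_norm \<Omega> (\<lambda>x. f x - g x) < \<infinity>"
    using order_le_less_trans by fastforce
  have "hoelder_quotient \<Omega> \<alpha> (\<lambda>x. - g x) = hoelder_quotient \<Omega> \<alpha> g"
    using hoelder_quotient_uminus[of \<Omega> \<alpha> "\<lambda>x. 0" g] by simp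
  then have "hoelder_quotient \<Omega> \<alpha> (\<lambda>x. f x - g x) \<le> hoelder_quotient \<Omega> \<alpha> f + hoelder_quotient \<Omega> \<alpha> g"
    using hoelder_quotient_triangle[of \<Omega> \<alpha> f "\<lambda>x. - g x"] by simp
  also have "\<dots> < \<infinity>" using assms by (simp add: hoelder_space_def)
  finally show ?thesis using 1 by simp
qed

lemma Metric_space_hoelder:
  assumes "bounded \<Omega>"
  shows "Metric_space (hoelder_space \<Omega> \<alpha>) (hoelder_dist \<Omega> \<alpha>)"
proof
  fix f g show "0 \<le> hoelder_dist \<Omega> \<alpha> f g" by (simp add: hoelder_dist_def hoelder_norm_def)
next
  fix f g show "hoelder_dist \<Omega> \<alpha> f g = hoelder_dist \<Omega> \<alpha> g f"
    using sup_norm_uminus[of \<Omega> f g] hoelder_quotient_uminus[of \<Omega> \<alpha> f g]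
    by (simp add: hoelder_dist_def hoelder_norm_def)
next
  fix f g assume fg: "f \<in> hoelder_space \<Omega> \<alpha>" "g \<in> hoelder_space \<Omega> \<alpha>"
  note fin = hoelder_norm_finite_diff[OF assms fg]
  show "hoelder_dist \<Omega> \<alpha> f g = 0 \<longleftrightarrow> f = g"
  proof
    assume "hoelder_dist \<Omega> \<alpha> f g = 0"
    then have "sup_norm \<Omega> (\<lambda>x. f x - g x) = 0"
      using fin by (auto simp: hoelder_dist_def hoelder_norm_def enn2real_eq_0_iff)
    then have "\<bar>f x - g x\<bar> \<le> 0" if "x \<in> closure \<Omega>" for x
      using SUP_upper[OF that, of "\<lambda>x. ennreal \<bar>f x - g x\<bar>"] by (simp add: sup_norm_def)
    then have "f x = g x" if "x \<in> closure \<Omega>" for x using that by force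
    then show "f = g"
      using fg by (intro extensionalityI[of _ "closure \<Omega>"]) (auto simp: hoelder_space_def C0_space_def)
  next
    assume "f = g"
    then show "hoelder_dist \<Omega> \<alpha> f g = 0"
      by (simp add: hoelder_dist_def hoelder_norm_def sup_norm_def hoelder_quotient_def
          case_prod_beta image_constant_conv SUP_constant bot_ennreal)
  qed
next
  fix f g h assume fgh: "f \<in> hoelder_space \<Omega> \<alpha>" "g \<in> hoelder_space \<Omega> \<alpha>" "h \<in> hoelder_space \<Omega> \<alpha>"
  let ?N = "\<lambda>f. sup_norm \<Omega> f + hoelder_quotient \<Omega> \<alpha> f"
  have "?N (\<lambda>x. f x - h x) \<le> ?N (\<lambda>x. f x - g x) + ?N (\<lambda>x. g x - h x)"
    using add_mono[OF sup_norm_triangle[of \<Omega> "\<lambda>x. f x - g x" "\<lambda>x. g x - h x"]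
        hoelder_quotient_triangle[of \<Omega> \<alpha> "\<lambda>x. f x - g x" "\<lambda>x. g x - h x"]]
    by (simp add: algebra_simps)
  moreover have "?N (\<lambda>x. f x - g x) < \<infinity>" "?N (\<lambda>x. g x - h x) < \<infinity>"
    using hoelder_norm_finite_diff[OF assms] fgh by blast+
  ultimately show "hoelder_dist \<Omega> \<alpha> f h \<le> hoelder_dist \<Omega> \<alpha> f g + hoelder_dist \<Omega> \<alpha> g h"
    unfolding hoelder_dist_def hoelder_norm_def
    by (subst enn2real_plus[symmetric]) (auto intro!: enn2real_mono)
qed

lemma topspace_hoelder_topology:
  "bounded \<Omega> \<Longrightarrow> topspace (hoelder_topology \<Omega> \<alpha>) = hoelder_space \<Omega> \<alpha>"
  by (simp add: hoelder_topology_def Metric_space.topspace_mtopology Metric_space_hoelder)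

end

(* Finitely many real functions, each bounded on A, admit a finite subset of A that is a net for all
   of them at once. With A = K and the evaluations k |-> S[k](p_F), one point p_F in each covering set
   F, together with one evaluation k |-> k(x0), this gives total boundedness of K: the oscillation
   bound on the F makes the Hoelder quotients of two members close everywhere, and with the value at
   x0 that controls the sup norm because Omega is bounded (connectedness plays no role).
   With the roles exchanged, A = (Omega x Omega) - Delta and the functions S[l] for l in a finite net
   of K, the net points are the centres of a covering by preimages of balls. *)
theory Submission
  imports Defs
begin

section \<open>Finite nets for finitely many bounded functions\<close>

text \<open>Pigeonhole on a grid of mesh \<open>\<delta>\<close>: boundedness leaves finitely many
  vectors of grid cells, and two points with the same vector differ by less than
  \<open>\<delta>\<close> under every function in \<open>I\<close>. One representative per attained
  vector gives the net.\<close>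

lemma finite_net_of_bounded_functions:
  fixes I :: "('a \<Rightarrow> real) set"
  assumes "finite I" and bdd: "\<And>\<phi>. \<phi> \<in> I \<Longrightarrow> bounded (\<phi> ` A)" and "0 < \<delta>"
  shows "\<exists>N. finite N \<and> N \<subseteq> A \<and> (\<forall>a\<in>A. \<exists>b\<in>N. \<forall>\<phi>\<in>I. \<bar>\<phi> a - \<phi> b\<bar> < \<delta>)"
proof -
  have "\<exists>B. \<forall>a\<in>A. \<bar>\<phi> a\<bar> \<le> B" if "\<phi> \<in> I" for \<phi>
    using bdd[OF that] by (auto simp: bounded_iff)
  then obtain B where B: "\<And>\<phi> a. \<phi> \<in> I \<Longrightarrow> a \<in> A \<Longrightarrow> \<bar>\<phi> a\<bar> \<le> B \<phi>"
    by metis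
  \<comment> \<open>Restricting to \<open>I\<close> makes each vector of cells extensional, so that
    all of them lie in a finite product \<open>PiE\<close> of integer intervals.\<close>
  define \<Phi> where "\<Phi> = (\<lambda>a. \<lambda>\<phi>\<in>I. \<lfloor>\<phi> a / \<delta>\<rfloor>)"
  have "\<Phi> ` A \<subseteq> PiE I (\<lambda>\<phi>. {\<lfloor>- B \<phi> / \<delta>\<rfloor>..\<lfloor>B \<phi> / \<delta>\<rfloor>})"
  proof (clarsimp simp: \<Phi>_def)
    fix a \<phi> assume "a \<in> A" "\<phi> \<in> I"
    then have "\<bar>\<phi> a\<bar> \<le> B \<phi>" by (rule B[rotated])
    then show "\<lfloor>- (B \<phi> / \<delta>)\<rfloor> \<le> \<lfloor>\<phi> a / \<delta>\<rfloor> \<and> \<lfloor>\<phi> a / \<delta>\<rfloor> \<le> \<lfloor>B \<phi> / \<delta>\<rfloor>"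
      using \<open>0 < \<delta>\<close> by (auto intro!: floor_mono simp: field_simps)
  qed
  then have "finite (\<Phi> ` A)"
    using \<open>finite I\<close> by (rule finite_subset[OF _ finite_PiE]) auto
  then obtain N where N: "N \<subseteq> A" "finite N" "\<Phi> ` A = \<Phi> ` N"
    using finite_subset_image[of "\<Phi> ` A" \<Phi> A] by auto
  show ?thesis
  proof (intro exI[of _ N] conjI N ballI)
    fix a assume "a \<in> A"
    then obtain b where b: "b \<in> N" "\<Phi> a = \<Phi> b" using N(3) by blast
    have "\<bar>\<phi> a - \<phi> b\<bar> < \<delta>" if "\<phi> \<in> I" for \<phi>
    proof -
      have "\<lfloor>\<phi> a / \<delta>\<rfloor> = \<lfloor>\<phi> b / \<delta>\<rfloor>"
        using fun_cong[OF b(2), of \<phi>] that by (simp add: \<Phi>_def)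
      then have "\<bar>\<phi> a / \<delta> - \<phi> b / \<delta>\<bar> < 1" by linarith
      then show ?thesis
        using \<open>0 < \<delta>\<close> by (simp add: diff_divide_distrib[symmetric])
    qed
    then show "\<exists>b\<in>N. \<forall>\<phi>\<in>I. \<bar>\<phi> a - \<phi> b\<bar> < \<delta>" using b(1) by blast
  qed
qed

section \<open>The Hoelder norm in terms of pointwise inequalities\<close>

text \<open>Clearing the denominator lets the diagonal pairs join in: for \<open>x = y\<close> both
  sides are 0, because \<open>0 powr \<alpha> = 0\<close>.\<close>

lemma hoelder_quotient_le_iff:
  assumes "0 \<le> B"
  shows "hoelder_quotient \<Omega> \<alpha> f \<le> ennreal B \<longleftrightarrow>
    (\<forall>x\<in>closure \<Omega>. \<forall>y\<in>closure \<Omega>. \<bar>f x - f y\<bar> \<le> B * norm (x - y) powr \<alpha>)"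
proof -
  have "\<bar>f x - f y\<bar> / norm (x - y) powr \<alpha> \<le> B \<longleftrightarrow> \<bar>f x - f y\<bar> \<le> B * norm (x - y) powr \<alpha>"
    if "x \<noteq> y" for x y
    using that by (simp add: pos_divide_le_eq)
  moreover have "(\<forall>x\<in>closure \<Omega>. \<forall>y\<in>closure \<Omega>. \<bar>f x - f y\<bar> \<le> B * norm (x - y) powr \<alpha>) \<longleftrightarrow>
      (\<forall>x\<in>closure \<Omega>. \<forall>y\<in>closure \<Omega>. x \<noteq> y \<longrightarrow> \<bar>f x - f y\<bar> \<le> B * norm (x - y) powr \<alpha>)"
    by (metis abs_zero diff_self norm_zero powr_0 mult_zero_right order_refl)
  ultimately show ?thesis
    using assms by (auto simp: hoelder_quotient_def SUP_le_iff ennreal_le_iff)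
qed

lemma sup_norm_le_iff:
  assumes "0 \<le> B"
  shows "sup_norm \<Omega> f \<le> ennreal B \<longleftrightarrow> (\<forall>x\<in>closure \<Omega>. \<bar>f x\<bar> \<le> B)"
  using assms by (auto simp: sup_norm_def SUP_le_iff ennreal_le_iff)

lemma mem_hoelder_space_iff:
  "f \<in> hoelder_space \<Omega> \<alpha> \<longleftrightarrow> f \<in> extensional (closure \<Omega>) \<and> continuous_on (closure \<Omega>) f \<and>
    (\<exists>B\<ge>0. \<forall>x\<in>closure \<Omega>. \<forall>y\<in>closure \<Omega>. \<bar>f x - f y\<bar> \<le> B * norm (x - y) powr \<alpha>)"
proof -
  have "hoelder_quotient \<Omega> \<alpha> f < \<infinity> \<longleftrightarrow> (\<exists>B\<ge>0. hoelder_quotient \<Omega> \<alpha> f \<le> ennreal B)"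
    by (cases "hoelder_quotient \<Omega> \<alpha> f") (auto simp: top_unique)
  then show ?thesis
    by (auto simp: hoelder_space_def C0_space_def hoelder_quotient_le_iff)
qed

lemma hoelder_dist_le:
  assumes "0 \<le> A" "0 \<le> B"
    and "\<And>x. x \<in> closure \<Omega> \<Longrightarrow> \<bar>f x - g x\<bar> \<le> A"
    and "\<And>x y. x \<in> closure \<Omega> \<Longrightarrow> y \<in> closure \<Omega> \<Longrightarrow>
      \<bar>f x - g x - (f y - g y)\<bar> \<le> B * norm (x - y) powr \<alpha>"
  shows "hoelder_dist \<Omega> \<alpha> f g \<le> A + B"
proof -
  have "sup_norm \<Omega> (\<lambda>x. f x - g x) + hoelder_quotient \<Omega> \<alpha> (\<lambda>x. f x - g x) \<le> ennreal A + ennreal B"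
    using assms by (intro add_mono) (auto simp: sup_norm_le_iff hoelder_quotient_le_iff)
  then show ?thesis
    using assms(1,2) unfolding hoelder_dist_def hoelder_norm_def
    by (intro enn2real_leI) auto
qed

lemma hoelder_dist_bounds:
  assumes "bounded \<Omega>" "f \<in> hoelder_space \<Omega> \<alpha>" "g \<in> hoelder_space \<Omega> \<alpha>"
    and "x \<in> closure \<Omega>"
  shows "\<bar>f x - g x\<bar> \<le> hoelder_dist \<Omega> \<alpha> f g"
    and "y \<in> closure \<Omega> \<Longrightarrow>
      \<bar>f x - g x - (f y - g y)\<bar> \<le> hoelder_dist \<Omega> \<alpha> f g * norm (x - y) powr \<alpha>"
proof -
  let ?h = "\<lambda>x. f x - g x"
  \<comment> \<open>\<open>enn2real\<close> sends infinity to 0, so recovering the extended sum from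
    the real distance requires finiteness of the norm of the difference.\<close>
  have "sup_norm \<Omega> ?h + hoelder_quotient \<Omega> \<alpha> ?h = ennreal (hoelder_dist \<Omega> \<alpha> f g)"
    using hoelder_norm_finite_diff[OF assms(1-3)]
    by (simp add: hoelder_dist_def hoelder_norm_def ennreal_enn2real_if less_top)
  then have *: "sup_norm \<Omega> ?h \<le> ennreal (hoelder_dist \<Omega> \<alpha> f g)"
    "hoelder_quotient \<Omega> \<alpha> ?h \<le> ennreal (hoelder_dist \<Omega> \<alpha> f g)"
    by (metis le_iff_add, metis le_iff_add add.commute)
  have pos: "0 \<le> hoelder_dist \<Omega> \<alpha> f g"
    by (simp add: hoelder_dist_def hoelder_norm_def)
  show "\<bar>f x - g x\<bar> \<le> hoelder_dist \<Omega> \<alpha> f g"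
    using * assms(4) by (simp add: sup_norm_le_iff pos)
  show "\<bar>f x - g x - (f y - g y)\<bar> \<le> hoelder_dist \<Omega> \<alpha> f g * norm (x - y) powr \<alpha>"
    if "y \<in> closure \<Omega>"
    using *(2) assms(4) that by (simp add: hoelder_quotient_le_iff pos)
qed

text \<open>The functions S[k] see only pairs in \<Omega>, whereas the norm takes suprema over the
  closure. The estimate passes to the closure by continuity in the pair (x, y); on the diagonal
  \<open>norm (x - y) powr \<alpha>\<close> is continuous because
  \<open>0 < \<alpha>\<close>.\<close>

lemma hoelder_bound_closure:
  fixes \<Omega> :: "(real ^ 'n) set"
  assumes "0 < \<alpha>" "continuous_on (closure \<Omega>) h"
    and le: "\<And>x y. x \<in> \<Omega> \<Longrightarrow> y \<in> \<Omega> \<Longrightarrow> \<bar>h x - h y\<bar> \<le> B * norm (x - y) powr \<alpha>"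
    and "x \<in> closure \<Omega>" "y \<in> closure \<Omega>"
  shows "\<bar>h x - h y\<bar> \<le> B * norm (x - y) powr \<alpha>"
proof -
  let ?u = "\<lambda>p. \<bar>h (fst p) - h (snd p)\<bar> - B * norm (fst p - snd p) powr \<alpha>"
  have "continuous_on (closure \<Omega> \<times> closure \<Omega>) (\<lambda>p. h (fst p))"
    "continuous_on (closure \<Omega> \<times> closure \<Omega>) (\<lambda>p. h (snd p))"
    by (rule continuous_on_compose2[OF assms(2)]; auto intro: continuous_intros)+
  then have "continuous_on (closure (\<Omega> \<times> \<Omega>)) ?u"
    using assms(1) unfolding closure_Times
    by (intro continuous_intros continuous_on_powr') auto
  then have "?u (x, y) \<le> 0"
    by (rule continuous_le_on_closure) (use assms in \<open>auto simp: closure_Times\<close>)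
  then show ?thesis by simp
qed

section \<open>Completeness, and relative compactness as total boundedness\<close>

text \<open>The distance dominates the sup distance, so a Cauchy sequence converges uniformly.
  Letting one index tend to infinity in the Cauchy estimates shows that the limit is Hoelder and
  that convergence holds in the full norm.\<close>

lemma mcomplete_hoelder:
  fixes \<Omega> :: "(real ^ 'n) set"
  assumes "bounded \<Omega>"
  shows "Metric_space.mcomplete (hoelder_space \<Omega> \<alpha>) (hoelder_dist \<Omega> \<alpha>)"
proof -
  interpret Metric_space "hoelder_space \<Omega> \<alpha>" "hoelder_dist \<Omega> \<alpha>"
    using assms by (rule Metric_space_hoelder)
  show ?thesis
    unfolding mcomplete_def
  proof (intro allI impI)
    fix \<sigma> assume cauchy: "MCauchy \<sigma>"
    then have mem: "\<sigma> n \<in> hoelder_space \<Omega> \<alpha>" for n by (auto simp: MCauchy_def)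
    note bounds = hoelder_dist_bounds[OF assms mem mem]
    have "uniformly_Cauchy_on (closure \<Omega>) \<sigma>"
    proof (rule uniformly_Cauchy_onI)
      fix e :: real assume "0 < e"
      then obtain M where "\<And>m n. M \<le> m \<Longrightarrow> M \<le> n \<Longrightarrow> hoelder_dist \<Omega> \<alpha> (\<sigma> m) (\<sigma> n) < e"
        using cauchy unfolding MCauchy_def by blast
      then show "\<exists>M. \<forall>x\<in>closure \<Omega>. \<forall>m\<ge>M. \<forall>n\<ge>M. dist (\<sigma> m x) (\<sigma> n x) < e"
        unfolding dist_real_def by (meson bounds(1) le_less_trans)
    qed
    then obtain g where g: "uniform_limit (closure \<Omega>) \<sigma> g sequentially"
      using Cauchy_uniformly_convergent unfolding uniformly_convergent_on_def by blast
    \<comment> \<open>Elements of the space are extensional, so the uniform limit is normalised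
      outside the closure.\<close>
    define f where "f = restrict g (closure \<Omega>)"
    have lim: "(\<lambda>n. \<sigma> n x) \<longlonglongrightarrow> f x" if "x \<in> closure \<Omega>" for x
      using tendsto_uniform_limitI[OF g that] that by (simp add: f_def)
    have "continuous_on (closure \<Omega>) g"
      using mem by (intro uniform_limit_theorem[OF _ g] always_eventually)
        (auto simp: hoelder_space_def C0_space_def)
    then have cont: "continuous_on (closure \<Omega>) f" by (simp add: f_def)
    \<comment> \<open>With n fixed and m tending to infinity, the strict Cauchy bounds survive as
      weak ones for the limit.\<close>
    have approx: "\<exists>N. \<forall>n\<ge>N. (\<forall>x\<in>closure \<Omega>. \<bar>\<sigma> n x - f x\<bar> \<le> e) \<and>
        (\<forall>x\<in>closure \<Omega>. \<forall>y\<in>closure \<Omega>. \<bar>\<sigma> n x - f x - (\<sigma> n y - f y)\<bar> \<le> e * norm (x - y) powr \<alpha>)"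
      if "0 < e" for e
    proof -
      obtain N where N: "\<And>m n. N \<le> m \<Longrightarrow> N \<le> n \<Longrightarrow> hoelder_dist \<Omega> \<alpha> (\<sigma> m) (\<sigma> n) < e"
        using cauchy \<open>0 < e\<close> unfolding MCauchy_def by blast
      have "\<bar>\<sigma> n x - f x\<bar> \<le> e" if "n \<ge> N" and x: "x \<in> closure \<Omega>" for n x
      proof (rule LIMSEQ_le_const2)
        show "(\<lambda>m. \<bar>\<sigma> n x - \<sigma> m x\<bar>) \<longlonglongrightarrow> \<bar>\<sigma> n x - f x\<bar>"
          by (intro tendsto_intros lim x)
        show "\<exists>M. \<forall>m\<ge>M. \<bar>\<sigma> n x - \<sigma> m x\<bar> \<le> e"
          using N[OF \<open>n \<ge> N\<close>] bounds(1)[OF x] by (meson le_less_trans less_imp_le)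
      qed
      moreover have "\<bar>\<sigma> n x - f x - (\<sigma> n y - f y)\<bar> \<le> e * norm (x - y) powr \<alpha>"
        if "n \<ge> N" and x: "x \<in> closure \<Omega>" and y: "y \<in> closure \<Omega>" for n x y
      proof (rule LIMSEQ_le_const2)
        show "(\<lambda>m. \<bar>\<sigma> n x - \<sigma> m x - (\<sigma> n y - \<sigma> m y)\<bar>) \<longlonglongrightarrow> \<bar>\<sigma> n x - f x - (\<sigma> n y - f y)\<bar>"
          by (intro tendsto_intros lim x y)
        have "\<bar>\<sigma> n x - \<sigma> m x - (\<sigma> n y - \<sigma> m y)\<bar> \<le> e * norm (x - y) powr \<alpha>" if "m \<ge> N" for m
          using bounds(2)[OF x y, of n m] mult_right_mono[OF less_imp_le[OF N[OF \<open>n \<ge> N\<close> that]],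
              of "norm (x - y) powr \<alpha>"] by simp
        then show "\<exists>M. \<forall>m\<ge>M. \<bar>\<sigma> n x - \<sigma> m x - (\<sigma> n y - \<sigma> m y)\<bar> \<le> e * norm (x - y) powr \<alpha>"
          by blast
      qed
      ultimately show ?thesis by blast
    qed
    have f: "f \<in> hoelder_space \<Omega> \<alpha>"
    proof -
      \<comment> \<open>A single term whose difference from \<open>f\<close> has Hoelder constant at
        most 1 suffices: if \<open>B\<close> is a constant for that term, \<open>B + 1\<close> is
        one for \<open>f\<close>.\<close>
      obtain n where n: "\<And>x y. x \<in> closure \<Omega> \<Longrightarrow> y \<in> closure \<Omega> \<Longrightarrow>
          \<bar>\<sigma> n x - f x - (\<sigma> n y - f y)\<bar> \<le> 1 * norm (x - y) powr \<alpha>"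
        using approx[OF zero_less_one] by (meson order_refl)
      obtain B where B: "0 \<le> B" "\<And>x y. x \<in> closure \<Omega> \<Longrightarrow> y \<in> closure \<Omega> \<Longrightarrow>
          \<bar>\<sigma> n x - \<sigma> n y\<bar> \<le> B * norm (x - y) powr \<alpha>"
        using mem[of n] unfolding mem_hoelder_space_iff by blast
      have "\<bar>f x - f y\<bar> \<le> (B + 1) * norm (x - y) powr \<alpha>"
        if "x \<in> closure \<Omega>" "y \<in> closure \<Omega>" for x y
        using n[OF that] B(2)[OF that] by (simp add: distrib_right)
      then show ?thesis
        using B(1) cont unfolding mem_hoelder_space_iff
        by (auto simp: f_def intro!: exI[of _ "B + 1"])
    qed
    have "limitin mtopology \<sigma> f sequentially"
      unfolding limit_metric_sequentially
    proof (intro conjI f allI impI)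
      fix e :: real assume "0 < e"
      \<comment> \<open>The sup part and the quotient part each get \<open>e / 3\<close>, leaving a
        third as slack for the strict inequality.\<close>
      then obtain N where N: "\<And>n. n \<ge> N \<Longrightarrow> (\<forall>x\<in>closure \<Omega>. \<bar>\<sigma> n x - f x\<bar> \<le> e / 3) \<and>
          (\<forall>x\<in>closure \<Omega>. \<forall>y\<in>closure \<Omega>. \<bar>\<sigma> n x - f x - (\<sigma> n y - f y)\<bar> \<le> e / 3 * norm (x - y) powr \<alpha>)"
        using approx[of "e / 3"] by auto
      have "hoelder_dist \<Omega> \<alpha> (\<sigma> n) f \<le> e / 3 + e / 3" if "n \<ge> N" for n
        using N[OF that] \<open>0 < e\<close> by (intro hoelder_dist_le) auto
      then show "\<exists>N. \<forall>n\<ge>N. \<sigma> n \<in> hoelder_space \<Omega> \<alpha> \<and> hoelder_dist \<Omega> \<alpha> (\<sigma> n) f < e"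
        using mem \<open>0 < e\<close> by (intro exI[of _ N]) (force simp: field_simps)
    qed
    then show "\<exists>f. limitin mtopology \<sigma> f sequentially" by blast
  qed
qed

text \<open>By completeness, compact closure amounts to having finite nets of every size, which is
  the form used in both directions of the equivalence.\<close>

lemma relatively_compactin_hoelder_iff:
  assumes "bounded \<Omega>"
  shows "relatively_compactin (hoelder_topology \<Omega> \<alpha>) K \<longleftrightarrow>
    Metric_space.mtotally_bounded (hoelder_space \<Omega> \<alpha>) (hoelder_dist \<Omega> \<alpha>) K"
proof -
  interpret Metric_space "hoelder_space \<Omega> \<alpha>" "hoelder_dist \<Omega> \<alpha>"
    using assms by (rule Metric_space_hoelder)
  show ?thesis
    using mtotally_bounded_eq_compact_closure_of[OF mcomplete_hoelder[OF assms]]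
    by (simp add: relatively_compactin_def hoelder_topology_def)
qed

lemma relatively_compactin_real_iff: "relatively_compactin euclideanreal A \<longleftrightarrow> bounded A"
  by (simp add: relatively_compactin_def)

section \<open>The difference quotients S off the diagonal\<close>

lemma mem_off_diagonal_iff: "(x, y) \<in> off_diagonal \<Omega> \<longleftrightarrow> x \<in> \<Omega> \<and> y \<in> \<Omega> \<and> x \<noteq> y"
  by (auto simp: off_diagonal_def)

lemma continuous_on_S_quotient:
  fixes \<Omega> :: "(real ^ 'n) set"
  assumes "continuous_on \<Omega> f"
  shows "continuous_on (off_diagonal \<Omega>) (S_quotient \<alpha> f)"
proof -
  have "continuous_on (off_diagonal \<Omega>) (\<lambda>p. f (fst p))"
    "continuous_on (off_diagonal \<Omega>) (\<lambda>p. f (snd p))"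
    by (rule continuous_on_compose2[OF assms]; auto simp: off_diagonal_def intro: continuous_intros)+
  then show ?thesis
    unfolding S_quotient_def case_prod_beta
    by (intro continuous_intros) (auto simp: off_diagonal_def)
qed

lemma abs_S_quotient_diff_le_iff:
  assumes "x \<noteq> y"
  shows "\<bar>S_quotient \<alpha> f (x, y) - S_quotient \<alpha> g (x, y)\<bar> \<le> c \<longleftrightarrow>
    \<bar>f x - g x - (f y - g y)\<bar> \<le> c * norm (x - y) powr \<alpha>"
proof -
  have "S_quotient \<alpha> f (x, y) - S_quotient \<alpha> g (x, y) = (f x - g x - (f y - g y)) / norm (x - y) powr \<alpha>"
    by (simp add: S_quotient_def diff_divide_distrib[symmetric])
  then show ?thesis
    using assms by (simp add: pos_divide_le_eq)
qed

text \<open>S is a contraction into the bounded functions off the diagonal. Hence a net of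
  \<open>K\<close> also approximates the quotients S[k] uniformly.\<close>

lemma abs_S_quotient_diff_le_hoelder_dist:
  assumes "bounded \<Omega>" "f \<in> hoelder_space \<Omega> \<alpha>" "g \<in> hoelder_space \<Omega> \<alpha>" "p \<in> off_diagonal \<Omega>"
  shows "\<bar>S_quotient \<alpha> f p - S_quotient \<alpha> g p\<bar> \<le> hoelder_dist \<Omega> \<alpha> f g"
proof (cases p)
  case (Pair x y)
  then have "x \<in> closure \<Omega>" "y \<in> closure \<Omega>" "x \<noteq> y"
    using assms(4) closure_subset[of \<Omega>] by (auto simp: mem_off_diagonal_iff)
  then show ?thesis
    using hoelder_dist_bounds(2)[OF assms(1-3)] by (simp add: Pair abs_S_quotient_diff_le_iff)
qed

lemma bounded_S_quotient:
  assumes "f \<in> hoelder_space \<Omega> \<alpha>"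
  shows "bounded (S_quotient \<alpha> f ` off_diagonal \<Omega>)"
proof -
  obtain B where B: "\<And>x y. x \<in> closure \<Omega> \<Longrightarrow> y \<in> closure \<Omega> \<Longrightarrow>
      \<bar>f x - f y\<bar> \<le> B * norm (x - y) powr \<alpha>"
    using assms unfolding mem_hoelder_space_iff by blast
  have "\<bar>S_quotient \<alpha> f (x, y)\<bar> \<le> B" if "(x, y) \<in> off_diagonal \<Omega>" for x y
  proof -
    have "x \<in> closure \<Omega>" "y \<in> closure \<Omega>" "x \<noteq> y"
      using that closure_subset[of \<Omega>] by (auto simp: mem_off_diagonal_iff)
    then show ?thesis
      using B by (simp add: S_quotient_def pos_divide_le_eq)
  qed
  then show ?thesis by (force simp: bounded_iff)
qed

text \<open>A converse to the contraction estimate. Closeness of the quotients bounds the Hoelder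
  part of f - g; any point is then compared directly with the one reference point, at distance at
  most the diameter, which bounds the sup part.\<close>

lemma hoelder_dist_le_pointwise:
  fixes \<Omega> :: "(real ^ 'n) set"
  assumes "bounded \<Omega>" "0 < \<alpha>" "f \<in> hoelder_space \<Omega> \<alpha>" "g \<in> hoelder_space \<Omega> \<alpha>"
    and "0 \<le> a" "0 \<le> c"
    and point: "\<Omega> \<noteq> {} \<Longrightarrow> \<exists>x\<in>\<Omega>. \<bar>f x - g x\<bar> \<le> a"
    and quot: "\<And>p. p \<in> off_diagonal \<Omega> \<Longrightarrow> \<bar>S_quotient \<alpha> f p - S_quotient \<alpha> g p\<bar> \<le> c"
  shows "hoelder_dist \<Omega> \<alpha> f g \<le> a + c * diameter (closure \<Omega>) powr \<alpha> + c"
proof (rule hoelder_dist_le)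
  have cont: "continuous_on (closure \<Omega>) (\<lambda>x. f x - g x)"
    using assms(3,4) by (intro continuous_intros) (auto simp: mem_hoelder_space_iff)
  have inner: "\<bar>f x - g x - (f y - g y)\<bar> \<le> c * norm (x - y) powr \<alpha>" if "x \<in> \<Omega>" "y \<in> \<Omega>" for x y
  proof (cases "x = y")
    case False
    with that quot[of "(x, y)"] show ?thesis
      by (simp add: mem_off_diagonal_iff abs_S_quotient_diff_le_iff)
  qed simp
  show quot': "\<bar>f x - g x - (f y - g y)\<bar> \<le> c * norm (x - y) powr \<alpha>"
    if "x \<in> closure \<Omega>" "y \<in> closure \<Omega>" for x y
    using hoelder_bound_closure[OF assms(2) cont inner that] .
  show "\<bar>f x - g x\<bar> \<le> a + c * diameter (closure \<Omega>) powr \<alpha>" if x: "x \<in> closure \<Omega>" for x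
  proof -
    have "\<Omega> \<noteq> {}" using x by auto
    then obtain y where "y \<in> \<Omega>" and y: "\<bar>f y - g y\<bar> \<le> a" using point by blast
    then have y': "y \<in> closure \<Omega>" using closure_subset by blast
    have "norm (x - y) \<le> diameter (closure \<Omega>)"
      using diameter_bounded_bound[OF bounded_closure[OF assms(1)] x y'] by (simp add: dist_norm)
    then have "c * norm (x - y) powr \<alpha> \<le> c * diameter (closure \<Omega>) powr \<alpha>"
      using assms(2,6) by (intro mult_left_mono powr_mono2) auto
    then show ?thesis using quot'[OF x y'] y by linarith
  qed
qed (use assms in auto)

lemma finite_common_covering:
  fixes \<Omega> :: "(real ^ 'n) set"
  assumes "finite L" "L \<subseteq> hoelder_space \<Omega> \<alpha>" "0 < \<delta>"
  shows "\<exists>\<F>. finite \<F> \<and> \<Union>\<F> = off_diagonal \<Omega> \<and>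
    (\<forall>F\<in>\<F>. openin (top_of_set (off_diagonal \<Omega>)) F) \<and>
    (\<forall>F\<in>\<F>. \<forall>p\<in>F. \<forall>q\<in>F. \<forall>l\<in>L. \<bar>S_quotient \<alpha> l p - S_quotient \<alpha> l q\<bar> \<le> 2 * \<delta>)"
proof -
  let ?D = "off_diagonal \<Omega>"
  have "bounded (\<phi> ` ?D)" if "\<phi> \<in> S_quotient \<alpha> ` L" for \<phi>
    using that assms(2) bounded_S_quotient by blast
  then have "\<exists>P. finite P \<and> P \<subseteq> ?D \<and> (\<forall>q\<in>?D. \<exists>p\<in>P. \<forall>\<phi>\<in>S_quotient \<alpha> ` L. \<bar>\<phi> q - \<phi> p\<bar> < \<delta>)"
    using assms(1,3) by (intro finite_net_of_bounded_functions finite_imageI)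
  then obtain P where P: "finite P"
    "\<forall>q\<in>?D. \<exists>p\<in>P. \<forall>\<phi>\<in>S_quotient \<alpha> ` L. \<bar>\<phi> q - \<phi> p\<bar> < \<delta>"
    by (elim exE conjE) (rule that)
  \<comment> \<open>The points whose quotients S[l] all lie within \<open>\<delta>\<close> of their
    values at the centre \<open>p\<close>. Comparing two of them through \<open>p\<close> gives the
    oscillation \<open>2 * \<delta>\<close>.\<close>
  define F where "F = (\<lambda>p. {q \<in> ?D. \<forall>l\<in>L. \<bar>S_quotient \<alpha> l q - S_quotient \<alpha> l p\<bar> < \<delta>})"
  have "openin (top_of_set ?D) (F p)" for p
  proof -
    have "continuous_on ?D (S_quotient \<alpha> l)" if "l \<in> L" for l
    proof (rule continuous_on_S_quotient, rule continuous_on_subset)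
      show "continuous_on (closure \<Omega>) l"
        using that assms(2) by (auto simp: mem_hoelder_space_iff)
    qed (rule closure_subset)
    \<comment> \<open>Intersecting with \<open>topspace\<close> matters for empty \<open>L\<close>,
      where the intersection over \<open>L\<close> is the whole type.\<close>
    then have "openin (top_of_set ?D)
        ((\<Inter>l\<in>L. ?D \<inter> S_quotient \<alpha> l -` ball (S_quotient \<alpha> l p) \<delta>) \<inter> topspace (top_of_set ?D))"
      using \<open>finite L\<close> by (intro openin_INT continuous_openin_preimage_gen) auto
    also have "(\<Inter>l\<in>L. ?D \<inter> S_quotient \<alpha> l -` ball (S_quotient \<alpha> l p) \<delta>) \<inter> topspace (top_of_set ?D) = F p"
      by (auto simp: F_def dist_real_def abs_minus_commute)
    finally show ?thesis .
  qed
  moreover have "\<Union>(F ` P) = ?D"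
    using P(2) by (fastforce simp: F_def)
  moreover have "\<bar>S_quotient \<alpha> l q - S_quotient \<alpha> l r\<bar> \<le> 2 * \<delta>"
    if "q \<in> F p" "r \<in> F p" "l \<in> L" for p q r l
  proof -
    have "\<bar>S_quotient \<alpha> l q - S_quotient \<alpha> l p\<bar> < \<delta>" "\<bar>S_quotient \<alpha> l r - S_quotient \<alpha> l p\<bar> < \<delta>"
      using that by (auto simp: F_def)
    then show ?thesis by linarith
  qed
  ultimately show ?thesis
    using P(1) by (intro exI[of _ "F ` P"]) blast
qed

section \<open>Finite nets of \<open>K\<close> against finite coverings of the off-diagonal
  set\<close>

theorem theorem2p4:
  fixes \<Omega> :: "(real ^ 'n) set" and \<alpha> :: real and K :: "(real ^ 'n \<Rightarrow> real) set"
  assumes "bounded \<Omega>" and "open \<Omega>" and "0 < \<alpha>" and "\<alpha> \<le> 1"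
    and "K \<subseteq> hoelder_space \<Omega> \<alpha>"
  shows "relatively_compactin (hoelder_topology \<Omega> \<alpha>) K \<longleftrightarrow>
    (\<forall>x\<in>\<Omega>. relatively_compactin euclideanreal {k x |k. k \<in> K}) \<and>
    (\<forall>\<epsilon>>0. \<exists>\<F>. finite \<F> \<and> \<Union>\<F> = off_diagonal \<Omega> \<and>
       (\<forall>F\<in>\<F>. openin (top_of_set (off_diagonal \<Omega>)) F) \<and>
       (\<forall>F\<in>\<F>. \<forall>k\<in>K. diameter (S_quotient \<alpha> k ` F) < \<epsilon>))"
proof -
  interpret Metric_space "hoelder_space \<Omega> \<alpha>" "hoelder_dist \<Omega> \<alpha>"
    using \<open>bounded \<Omega>\<close> by (rule Metric_space_hoelder)
  have mem: "k \<in> hoelder_space \<Omega> \<alpha>" if "k \<in> K" for k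
    using assms(5) that by blast
  have "mtotally_bounded K \<longleftrightarrow>
    (\<forall>x\<in>\<Omega>. bounded {k x |k. k \<in> K}) \<and>
    (\<forall>\<epsilon>>0. \<exists>\<F>. finite \<F> \<and> \<Union>\<F> = off_diagonal \<Omega> \<and>
       (\<forall>F\<in>\<F>. openin (top_of_set (off_diagonal \<Omega>)) F) \<and>
       (\<forall>F\<in>\<F>. \<forall>k\<in>K. diameter (S_quotient \<alpha> k ` F) < \<epsilon>))" (is "_ \<longleftrightarrow> ?bdd \<and> (\<forall>\<epsilon>>0. ?cover \<epsilon>)")
  proof (intro iffI conjI ballI allI impI)
    fix x assume tb: "mtotally_bounded K" and "x \<in> \<Omega>"
    then have x: "x \<in> closure \<Omega>" using closure_subset by blast
    obtain N where N: "finite N" "N \<subseteq> K" "K \<subseteq> (\<Union>l\<in>N. mball l 1)"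
      using tb[unfolded mtotally_bounded_def, rule_format, OF zero_less_one] by (elim exE conjE) (rule that)
    \<comment> \<open>The sum over the unit net stands in for a maximum, which covers the empty net
      too.\<close>
    have "\<bar>k x\<bar> \<le> (\<Sum>l\<in>N. \<bar>l x\<bar>) + 1" if "k \<in> K" for k
    proof -
      obtain l where l: "l \<in> N" "hoelder_dist \<Omega> \<alpha> l k < 1" using N(3) \<open>k \<in> K\<close> by fastforce
      then have "\<bar>l x - k x\<bar> < 1"
        using hoelder_dist_bounds(1)[OF \<open>bounded \<Omega>\<close> mem mem x, of l k] N(2) that by force
      moreover have "\<bar>l x\<bar> \<le> (\<Sum>l\<in>N. \<bar>l x\<bar>)"
        using member_le_sum[of l N "\<lambda>l. \<bar>l x\<bar>"] l(1) N(1) by simp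
      ultimately show ?thesis by linarith
    qed
    then show "bounded {k x |k. k \<in> K}" by (auto simp: bounded_iff)
  next
    fix \<epsilon> :: real assume tb: "mtotally_bounded K" and "0 < \<epsilon>"
    \<comment> \<open>Comparing k with a net element l at two points costs
      \<open>\<epsilon> / 8\<close> each, and l oscillates by at most
      \<open>2 * (\<epsilon> / 8)\<close> on a covering set. The total \<open>\<epsilon> / 2\<close>
      keeps the diameter, a supremum, strictly below \<open>\<epsilon>\<close>.\<close>
    then have "0 < \<epsilon> / 8" by simp
    obtain L where L: "finite L" "L \<subseteq> K" "K \<subseteq> (\<Union>l\<in>L. mball l (\<epsilon> / 8))"
      using tb[unfolded mtotally_bounded_def, rule_format, OF \<open>0 < \<epsilon> / 8\<close>] by (elim exE conjE) (rule that)
    have "L \<subseteq> hoelder_space \<Omega> \<alpha>" using L(2) assms(5) by blast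
    from finite_common_covering[OF L(1) this \<open>0 < \<epsilon> / 8\<close>]
    obtain \<F> where \<F>: "finite \<F>" "\<Union>\<F> = off_diagonal \<Omega>"
        "\<forall>F\<in>\<F>. openin (top_of_set (off_diagonal \<Omega>)) F"
      and osc: "\<forall>F\<in>\<F>. \<forall>p\<in>F. \<forall>q\<in>F. \<forall>l\<in>L.
        \<bar>S_quotient \<alpha> l p - S_quotient \<alpha> l q\<bar> \<le> 2 * (\<epsilon> / 8)"
      by (elim exE conjE) (rule that)
    have "diameter (S_quotient \<alpha> k ` F) < \<epsilon>" if "F \<in> \<F>" "k \<in> K" for F k
    proof -
      obtain l where l: "l \<in> L" "hoelder_dist \<Omega> \<alpha> l k < \<epsilon> / 8" using L(3) \<open>k \<in> K\<close> by fastforce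
      have near: "\<bar>S_quotient \<alpha> l p - S_quotient \<alpha> k p\<bar> < \<epsilon> / 8" if "p \<in> F" for p
        using abs_S_quotient_diff_le_hoelder_dist[OF \<open>bounded \<Omega>\<close> mem mem, of l k p]
          \<open>F \<in> \<F>\<close> \<F>(2) L(2) l \<open>k \<in> K\<close> that by fastforce
      have "diameter (S_quotient \<alpha> k ` F) \<le> \<epsilon> / 2"
      proof (rule diameter_le)
        fix s t assume "s \<in> S_quotient \<alpha> k ` F" "t \<in> S_quotient \<alpha> k ` F"
        then obtain p q where pq: "p \<in> F" "q \<in> F" "s = S_quotient \<alpha> k p" "t = S_quotient \<alpha> k q" by blast
        show "norm (s - t) \<le> \<epsilon> / 2"
          using near[OF pq(1)] near[OF pq(2)] osc[rule_format, OF \<open>F \<in> \<F>\<close> pq(1,2) l(1)] pq(3,4)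
          unfolding real_norm_def by linarith
      qed (use \<open>0 < \<epsilon>\<close> in simp)
      then show ?thesis using \<open>0 < \<epsilon>\<close> by simp
    qed
    then show "?cover \<epsilon>" using \<F> by blast
  next
    assume "?bdd \<and> (\<forall>\<epsilon>>0. ?cover \<epsilon>)"
    then have pointwise: "\<And>x. x \<in> \<Omega> \<Longrightarrow> bounded {k x |k. k \<in> K}"
      and cover: "\<And>\<epsilon>. 0 < \<epsilon> \<Longrightarrow> ?cover \<epsilon>" by blast+
    show "mtotally_bounded K"
      unfolding mtotally_bounded_def
    proof (intro allI impI)
      fix \<epsilon> :: real assume "0 < \<epsilon>"
      define R where "R = diameter (closure \<Omega>) powr \<alpha>"
      have "0 \<le> R" by (simp add: R_def)
      \<comment> \<open>The final estimate is
        \<open>\<delta> + 3 * \<delta> * R + 3 * \<delta>\<close>, that is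
        \<open>\<delta> * (4 + 3 * R)\<close>; the 5 leaves one \<open>\<delta>\<close> to make it
        strict.\<close>
      define \<delta> where "\<delta> = \<epsilon> / (5 + 3 * R)"
      have "0 < \<delta>" using \<open>0 < \<epsilon>\<close> \<open>0 \<le> R\<close> by (simp add: \<delta>_def)
      obtain \<F> where \<F>: "finite \<F>" "\<Union>\<F> = off_diagonal \<Omega>"
          "\<And>F k. F \<in> \<F> \<Longrightarrow> k \<in> K \<Longrightarrow> diameter (S_quotient \<alpha> k ` F) < \<delta>"
        using cover[OF \<open>0 < \<delta>\<close>] by blast
      \<comment> \<open>A sample point of each covering set. It is meaningless for the empty set,
        which is therefore removed in \<open>I\<close>.\<close>
      define pt where "pt F = (SOME p. p \<in> F)" for F :: "((real ^ 'n) \<times> (real ^ 'n)) set"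
      have pt: "pt F \<in> F" if "F \<noteq> {}" for F using that by (auto simp: pt_def some_in_eq)
      \<comment> \<open>At most one reference point, and none when \<Omega> is empty, so that this
        case needs no separate treatment.\<close>
      define X where "X = (if \<Omega> = {} then {} else {SOME x. x \<in> \<Omega>})"
      have X: "finite X" "X \<subseteq> \<Omega>" "\<Omega> \<noteq> {} \<Longrightarrow> X \<noteq> {}"
        by (auto simp: X_def some_in_eq)
      define I where "I = (\<lambda>x k. k x) ` X \<union> (\<lambda>F k. S_quotient \<alpha> k (pt F)) ` (\<F> - {{}})"
      have bounded_eval: "bounded ((\<lambda>k. k x) ` K)" if "x \<in> \<Omega>" for x
        using pointwise[OF that] by (simp add: image_def Bex_def conj_commute)
      have "bounded (\<phi> ` K)" if \<phi>: "\<phi> \<in> I" for \<phi>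
      proof -
        consider x where "x \<in> \<Omega>" "\<phi> = (\<lambda>k. k x)"
          | x y where "x \<in> \<Omega>" "y \<in> \<Omega>" "\<phi> = (\<lambda>k. S_quotient \<alpha> k (x, y))"
        proof -
          have "pt F \<in> off_diagonal \<Omega>" if "F \<in> \<F> - {{}}" for F
            using pt[of F] that \<F>(2) by blast
          then show ?thesis
            using \<phi> X(2) that unfolding I_def by (fastforce simp: off_diagonal_def)
        qed
        then show ?thesis
        proof cases
          case 1
          then show ?thesis using bounded_eval by simp
        next
          case 2
          \<comment> \<open>For a fixed pair, S[k](x, y) is a fixed multiple of k x - k y, so
            boundedness of \<open>K\<close> at the two points bounds it uniformly in k.\<close>
          have "bounded ((\<lambda>k. k x - k y) ` K)"
            using bounded_minus_comp[OF bounded_eval[OF 2(1)] bounded_eval[OF 2(2)]] .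
          then have "bounded ((\<lambda>t. inverse (norm (x - y) powr \<alpha>) *\<^sub>R t) ` (\<lambda>k. k x - k y) ` K)"
            by (rule bounded_scaling)
          also have "(\<lambda>t. inverse (norm (x - y) powr \<alpha>) *\<^sub>R t) ` (\<lambda>k. k x - k y) ` K = \<phi> ` K"
            by (simp add: image_image 2(3) S_quotient_def divide_inverse mult.commute)
          finally show ?thesis .
        qed
      qed
      moreover have "finite I" using X(1) \<F>(1) by (simp add: I_def)
      ultimately obtain N where N: "finite N" "N \<subseteq> K"
          and near: "\<forall>k\<in>K. \<exists>l\<in>N. \<forall>\<phi>\<in>I. \<bar>\<phi> k - \<phi> l\<bar> < \<delta>"
        using finite_net_of_bounded_functions[of I K \<delta>] \<open>0 < \<delta>\<close> by meson
      have "\<exists>l\<in>N. k \<in> mball l \<epsilon>" if k: "k \<in> K" for k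
      proof -
        obtain l where l: "l \<in> N" "\<And>\<phi>. \<phi> \<in> I \<Longrightarrow> \<bar>\<phi> k - \<phi> l\<bar> < \<delta>" using near k by blast
        then have "l \<in> K" using N(2) by blast
        have osc: "\<bar>S_quotient \<alpha> h p - S_quotient \<alpha> h q\<bar> < \<delta>"
          if "h \<in> K" "F \<in> \<F>" "p \<in> F" "q \<in> F" for h F p q
        proof -
          \<comment> \<open>\<open>diameter\<close> controls distances only in bounded sets; here
            S[h] is bounded because h is Hoelder.\<close>
          have "bounded (S_quotient \<alpha> h ` F)"
            using \<F>(2) \<open>F \<in> \<F>\<close>
            by (intro bounded_subset[OF bounded_S_quotient[OF mem[OF \<open>h \<in> K\<close>]]]) auto
          then have "dist (S_quotient \<alpha> h p) (S_quotient \<alpha> h q) \<le> diameter (S_quotient \<alpha> h ` F)"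
            using that by (intro diameter_bounded_bound) auto
          then show ?thesis using \<F>(3)[OF that(2,1)] by (simp add: dist_real_def)
        qed
        \<comment> \<open>Three moves of size \<open>\<delta>\<close>: from \<open>p\<close> to the
          sample point for l, from l to k at the sample point, and back to \<open>p\<close> for
          k.\<close>
        have "\<bar>S_quotient \<alpha> l p - S_quotient \<alpha> k p\<bar> \<le> 3 * \<delta>" if "p \<in> off_diagonal \<Omega>" for p
        proof -
          have "p \<in> \<Union>\<F>" using \<F>(2) that by simp
          then obtain F where F: "F \<in> \<F>" "p \<in> F" by (rule UnionE)
          then have "pt F \<in> F" using pt by blast
          have "(\<lambda>k. S_quotient \<alpha> k (pt F)) \<in> I" using F by (auto simp: I_def)
          from l(2)[OF this] osc[OF \<open>l \<in> K\<close> F \<open>pt F \<in> F\<close>] osc[OF k F \<open>pt F \<in> F\<close>]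
          show ?thesis by linarith
        qed
        moreover have "\<exists>x\<in>\<Omega>. \<bar>l x - k x\<bar> \<le> \<delta>" if nonempty: "\<Omega> \<noteq> {}"
        proof -
          obtain x where x: "x \<in> X" "x \<in> \<Omega>" using X(2) X(3)[OF nonempty] by blast
          then have "(\<lambda>k. k x) \<in> I" by (auto simp: I_def)
          from l(2)[OF this] x(2) show ?thesis by (intro bexI[of _ x]) auto
        qed
        ultimately have "hoelder_dist \<Omega> \<alpha> l k \<le> \<delta> + (3 * \<delta>) * R + 3 * \<delta>"
          unfolding R_def using assms(1,3) mem[OF \<open>l \<in> K\<close>] mem[OF k] \<open>0 < \<delta>\<close>
          by (intro hoelder_dist_le_pointwise) auto
        also have "\<dots> = \<delta> * (5 + 3 * R) - \<delta>" by (simp add: algebra_simps)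
        also have "\<dots> < \<epsilon>" using \<open>0 \<le> R\<close> \<open>0 < \<delta>\<close> by (simp add: \<delta>_def)
        finally show ?thesis
          using l(1) mem[OF \<open>l \<in> K\<close>] mem[OF k] by auto
      qed
      then show "\<exists>N. finite N \<and> N \<subseteq> K \<and> K \<subseteq> (\<Union>l\<in>N. mball l \<epsilon>)"
        using N by (intro exI[of _ N]) (simp add: subset_iff)
    qed
  qed
  then show ?thesis
    by (simp add: relatively_compactin_hoelder_iff[OF \<open>bounded \<Omega>\<close>] relatively_compactin_real_iff)
qed

end
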